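(* Let $(M,d)$ be a metric space of diameter $\mathrm{diam}$, let $k\ge 1$, and let $\sigma=(\sigma_1,\dots,\sigma_T)$ be a $k$-server request sequence on $M$. Let $\{s_i(t)\}_{i\in[k],t\in[T]}$ be a sequence of server positions that serves $\sigma$ with optimal total cost $\mathrm{OPT}(\sigma)$. For any $\varepsilon>0$, the pairwise-swapping procedure described in the context, run on $\{s_i(t)\}$ with parameter $\varepsilon$, returns a sequence of server positions $\{\hat s_i(t)\}_{i\in[k],t\in[T]}$ serving $\sigma$ that is $(1+\varepsilon,\beta)$-fair with respect to $\mathrm{OPT}(\sigma)$, i.e. every server $i$ incurs total cost at most $\frac{(1+\varepsilon)\mathrm{OPT}(\sigma)}{k}+\beta$, where $\beta=O\!\left(\frac{\log k\cdot \mathrm{diam}}{\varepsilon}\right)$. Moreover, the total cost of the returned solution is at most $\mathrm{OPT}(\sigma)+O\!\left(\frac{k\log k\cdot\mathrm{diam}}{\varepsilon}\right)$.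
   Context: The $k$-server problem: $k$ servers labeled $1,\dots,k$ start at given positions in a metric space $(M,d)$; at each time $t=1,\dots,T$ a request $\sigma_t\in M$ arrives and some server must be at $\sigma_t$ after step $t$; moving a server from $x$ to $y$ costs $d(x,y)$. For a solution, $c_i(t)$ is the distance moved by server $i$ at time $t$, $c_i=\sum_t c_i(t)$ is server $i$'s total cost, and the total cost is $\sum_i c_i$. $\mathrm{OPT}(\sigma)$ is the minimum total cost of any (offline) solution. A solution is $(\alpha,\beta)$-fair with respect to a baseline $w(\sigma)$ if $c_i\le \alpha w(\sigma)/k+\beta$ for all $i$. The swapping procedure: set $\beta=2(1+\varepsilon)\mathrm{diam}\,(\tfrac32+\log_{(2+2\varepsilon)/(2+\varepsilon)}k)$. Starting from the given optimal solution, repeat while the maximum total server cost exceeds $(1+\varepsilon)\mathrm{OPT}(\sigma)/k+\beta$: let $H$ be a server of maximum current total cost and $L$ a server of minimum current total cost; choose a time $z$ such that, if $H$ and $L$ exchange their future position sequences (and hence their future per-step costs) after time $z$, the difference of their resulting total costs is at most $\mathrm{diam}$; perform this exchange, where at time $z+1$ each of the two servers pays the distance from its own position at time $z$ to its new position at time $z+1$ (the swap penalty). All server costs include these swap penalties. Return the final position sequence.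
   Formalization: The bound β = O(log k·diam/ε) is stated for k ≥ 2 and ε up to an arbitrary fixed ε₀, with a constant depending on ε₀, since it fails at k = 1 (log k = 0 but β > 0) and uniformly as ε → ∞. *)

theory Defs
  imports "HOL-Analysis.Elementary_Metric_Spaces"
begin

(* Servers are indexed by {1..k}. A family of positions is s i t, the position of server i at
   time t in {0..T}; s i 0 is the starting position and requests arrive at times {1..T}. *)

definition solution ::
    "nat \<Rightarrow> nat \<Rightarrow> (nat \<Rightarrow> 'a) \<Rightarrow> (nat \<Rightarrow> 'a) \<Rightarrow> (nat \<Rightarrow> nat \<Rightarrow> 'a) \<Rightarrow> bool" where
  "solution k T p \<sigma> s \<longleftrightarrow>
     (\<forall>i\<in>{1..k}. s i 0 = p i) \<and> (\<forall>t\<in>{1..T}. \<exists>i\<in>{1..k}. s i t = \<sigma> t)"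

definition step_cost :: "(nat \<Rightarrow> nat \<Rightarrow> 'a::metric_space) \<Rightarrow> nat \<Rightarrow> nat \<Rightarrow> real" where
  "step_cost s i t = dist (s i (t - 1)) (s i t)"

definition server_cost :: "nat \<Rightarrow> (nat \<Rightarrow> nat \<Rightarrow> 'a::metric_space) \<Rightarrow> nat \<Rightarrow> real" where
  "server_cost T s i = (\<Sum>t=1..T. step_cost s i t)"

definition total_cost :: "nat \<Rightarrow> nat \<Rightarrow> (nat \<Rightarrow> nat \<Rightarrow> 'a::metric_space) \<Rightarrow> real" where
  "total_cost k T s = (\<Sum>i=1..k. server_cost T s i)"

(* The infimum is the minimum whenever some solution attains it. *)
definition opt_cost ::
    "nat \<Rightarrow> nat \<Rightarrow> (nat \<Rightarrow> 'a::metric_space) \<Rightarrow> (nat \<Rightarrow> 'a) \<Rightarrow> real" where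
  "opt_cost k T p \<sigma> = (INF s\<in>{s. solution k T p \<sigma> s}. total_cost k T s)"

definition fair ::
    "nat \<Rightarrow> nat \<Rightarrow> real \<Rightarrow> real \<Rightarrow> real \<Rightarrow> (nat \<Rightarrow> nat \<Rightarrow> 'a::metric_space) \<Rightarrow> bool" where
  "fair k T \<alpha> \<beta> w s \<longleftrightarrow> (\<forall>i\<in>{1..k}. server_cost T s i \<le> \<alpha> * w / real k + \<beta>)"

(* D is the diameter of the metric space. *)
definition swap_beta :: "real \<Rightarrow> nat \<Rightarrow> real \<Rightarrow> real" where
  "swap_beta \<epsilon> k D =
     2 * (1 + \<epsilon>) * D * (3/2 + log ((2 + 2 * \<epsilon>) / (2 + \<epsilon>)) (real k))"

definition max_server :: "nat \<Rightarrow> nat \<Rightarrow> (nat \<Rightarrow> nat \<Rightarrow> 'a::metric_space) \<Rightarrow> nat \<Rightarrow> bool" where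
  "max_server k T s H \<longleftrightarrow> H \<in> {1..k} \<and> (\<forall>i\<in>{1..k}. server_cost T s i \<le> server_cost T s H)"

definition min_server :: "nat \<Rightarrow> nat \<Rightarrow> (nat \<Rightarrow> nat \<Rightarrow> 'a::metric_space) \<Rightarrow> nat \<Rightarrow> bool" where
  "min_server k T s L \<longleftrightarrow> L \<in> {1..k} \<and> (\<forall>i\<in>{1..k}. server_cost T s L \<le> server_cost T s i)"

(* The cost of server a if it takes over the per-step costs of server b after time z. The swap
   penalty is not part of this quantity, which only serves to select the swap time; it does enter
   server_cost of the family after the swap. *)
definition exchanged_cost ::
    "nat \<Rightarrow> (nat \<Rightarrow> nat \<Rightarrow> 'a::metric_space) \<Rightarrow> nat \<Rightarrow> nat \<Rightarrow> nat \<Rightarrow> real" where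
  "exchanged_cost T s a b z =
     (\<Sum>t=1..z. step_cost s a t) + (\<Sum>t=z+1..T. step_cost s b t)"

definition balancing_time ::
    "nat \<Rightarrow> (nat \<Rightarrow> nat \<Rightarrow> 'a::metric_space) \<Rightarrow> nat \<Rightarrow> nat \<Rightarrow> nat \<Rightarrow> bool" where
  "balancing_time T s H L z \<longleftrightarrow> z \<in> {1..T} \<and>
     \<bar>exchanged_cost T s H L z - exchanged_cost T s L H z\<bar> \<le> diameter (UNIV :: 'a set)"

definition exchange :: "(nat \<Rightarrow> nat \<Rightarrow> 'a) \<Rightarrow> nat \<Rightarrow> nat \<Rightarrow> nat \<Rightarrow> nat \<Rightarrow> nat \<Rightarrow> 'a" where
  "exchange s H L z =
     s(H := \<lambda>t. if t \<le> z then s H t else s L t,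
       L := \<lambda>t. if t \<le> z then s L t else s H t)"

(* w is the baseline, i.e. the optimal cost of the instance. *)
definition swap_needed ::
    "nat \<Rightarrow> nat \<Rightarrow> real \<Rightarrow> real \<Rightarrow> (nat \<Rightarrow> nat \<Rightarrow> 'a::metric_space) \<Rightarrow> bool" where
  "swap_needed k T \<epsilon> w s \<longleftrightarrow>
     Max (server_cost T s ` {1..k})
       > (1 + \<epsilon>) * w / real k + swap_beta \<epsilon> k (diameter (UNIV :: 'a set))"

(* The procedure is nondeterministic in the choice of H, L and z, hence a relation. *)
definition swap_step ::
    "nat \<Rightarrow> nat \<Rightarrow> real \<Rightarrow> real \<Rightarrow> (nat \<Rightarrow> nat \<Rightarrow> 'a::metric_space) \<Rightarrow> (nat \<Rightarrow> nat \<Rightarrow> 'a) \<Rightarrow> bool" where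
  "swap_step k T \<epsilon> w s s' \<longleftrightarrow> swap_needed k T \<epsilon> w s \<and>
     (\<exists>H L z. max_server k T s H \<and> min_server k T s L \<and> balancing_time T s H L z \<and>
        s' = exchange s H L z)"

definition swapping_returns ::
    "nat \<Rightarrow> nat \<Rightarrow> real \<Rightarrow> real \<Rightarrow> (nat \<Rightarrow> nat \<Rightarrow> 'a::metric_space) \<Rightarrow> (nat \<Rightarrow> nat \<Rightarrow> 'a) \<Rightarrow> bool" where
  "swapping_returns k T \<epsilon> w s s' \<longleftrightarrow> (swap_step k T \<epsilon> w)\<^sup>*\<^sup>* s s' \<and> \<not> swap_needed k T \<epsilon> w s'"

end

theory Submission imports Defs begin

text \<open>
  Write \<open>w\<close> for the optimal cost, \<open>D\<close> for the diameter, \<open>r = (2 + 2\<epsilon>) / (2 + \<epsilon>)\<close> and \<open>\<theta>\<close> for the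
  stopping threshold. A swap adds at most \<open>2D\<close> to the total cost, so while at most \<open>k log\<^sub>r k\<close> swaps
  have been made, the cheapest server costs at most \<open>w/k + 2D log\<^sub>r k\<close>. The value of \<open>\<beta>\<close> is chosen
  such that then a server \<open>H\<close> above \<open>\<theta>\<close> costs at least \<open>(1 + \<epsilon>) (L + 3D)\<close>, and so both servers cost at
  most \<open>(H + L)/2 + 3D/2 \<le> H / r\<close> after the swap. Hence, as long as the maximum lies in
  \<open>(w / r\<^sup>j\<^sup>+\<^sup>1, w / r\<^sup>j]\<close>, every swap removes a server from this range. Only servers above \<open>\<theta>\<close> matter, and
  by averaging there are at most \<open>k / (1 + \<epsilon>)\<close> of them. Since \<open>\<theta> \<ge> (1 + \<epsilon>) w / k\<close> there are at most
  \<open>log\<^sub>r k\<close> such ranges, so fewer than \<open>k log\<^sub>r k / (1 + \<epsilon>)\<close> swaps take place. The factor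
  \<open>1 / (1 + \<epsilon>)\<close> is what makes the bound on the total cost hold for large \<open>\<epsilon>\<close> too.
\<close>

section \<open>Costs, exchanges and extremal servers\<close>

lemma step_cost_nonneg: "0 \<le> step_cost s i t"
  by (simp add: step_cost_def)

lemma server_cost_nonneg: "0 \<le> server_cost T s i"
  by (simp add: server_cost_def sum_nonneg step_cost_nonneg)

lemma total_cost_nonneg: "0 \<le> total_cost k T s"
  by (simp add: total_cost_def sum_nonneg server_cost_nonneg)

lemma sum_split_at:
  fixes f :: "nat \<Rightarrow> real"
  assumes "z \<le> T"
  shows "(\<Sum>t=1..T. f t) = (\<Sum>t=1..z. f t) + (\<Sum>t=z+1..T. f t)"
  using assms sum.ub_add_nat[of 1 z f "T - z"] by simp

text \<open>Up to penalties an exchange only redistributes the cost of the pair. With the sum fixed,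
  a small difference will bound both costs.\<close>

lemma exchanged_cost_add:
  assumes "z \<le> T"
  shows "exchanged_cost T s a b z + exchanged_cost T s b a z = server_cost T s a + server_cost T s b"
  using sum_split_at[OF assms, of "step_cost s a"] sum_split_at[OF assms, of "step_cost s b"]
  by (simp add: exchanged_cost_def server_cost_def)

text \<open>Lets bounds on the first server of an exchange be reused for the second.\<close>

lemma exchange_commute: "exchange s H L z = exchange s L H z"
  by (cases "H = L") (auto simp: exchange_def fun_upd_twist)

lemma exchange_other: "i \<noteq> H \<Longrightarrow> i \<noteq> L \<Longrightarrow> exchange s H L z i = s i"
  by (simp add: exchange_def)

lemma server_cost_exchange_other:
  "i \<noteq> H \<Longrightarrow> i \<noteq> L \<Longrightarrow> server_cost T (exchange s H L z) i = server_cost T s i"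
  by (simp add: server_cost_def step_cost_def exchange_other)

text \<open>At each time the same positions stay occupied: after \<open>z\<close> the two servers
  merely trade names.\<close>

lemma solution_exchange:
  assumes sol: "solution k T p \<sigma> s" and H: "H \<in> {1..k}" and L: "L \<in> {1..k}"
  shows "solution k T p \<sigma> (exchange s H L z)"
  unfolding solution_def
proof (intro conjI ballI)
  fix i assume "i \<in> {1..k}"
  then show "exchange s H L z i 0 = p i"
    using sol by (auto simp: solution_def exchange_def)
next
  fix t assume "t \<in> {1..T}"
  then obtain i where i: "i \<in> {1..k}" "s i t = \<sigma> t"
    using sol unfolding solution_def by blast
  show "\<exists>i\<in>{1..k}. exchange s H L z i t = \<sigma> t"
  proof (cases "t \<le> z")
    case True
    then have "exchange s H L z i t = \<sigma> t" using i by (auto simp: exchange_def)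
    then show ?thesis using i by blast
  next
    case False
    then have "exchange s H L z (if i = H then L else if i = L then H else i) t = \<sigma> t"
      using i by (auto simp: exchange_def)
    then show ?thesis using i H L by (metis (full_types))
  qed
qed

lemma max_server_exists:
  assumes "k \<ge> 1" shows "\<exists>H. max_server k T s H"
proof -
  have "Max (server_cost T s ` {1..k}) \<in> server_cost T s ` {1..k}"
    using assms by (intro Max_in) auto
  then obtain H where "H \<in> {1..k}" "server_cost T s H = Max (server_cost T s ` {1..k})" by auto
  then show ?thesis unfolding max_server_def by (metis Max_ge finite_atLeastAtMost finite_imageI imageI)
qed

lemma min_server_exists:
  assumes "k \<ge> 1" shows "\<exists>L. min_server k T s L"
proof -
  have "Min (server_cost T s ` {1..k}) \<in> server_cost T s ` {1..k}"
    using assms by (intro Min_in) auto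
  then obtain L where "L \<in> {1..k}" "server_cost T s L = Min (server_cost T s ` {1..k})" by auto
  then show ?thesis unfolding min_server_def by (metis Min_le finite_atLeastAtMost finite_imageI imageI)
qed

lemma server_cost_max_server:
  assumes "max_server k T s H"
  shows "Max (server_cost T s ` {1..k}) = server_cost T s H"
  using assms unfolding max_server_def by (intro Max_eqI) auto

lemma k_times_min_server_le:
  assumes "min_server k T s L"
  shows "real k * server_cost T s L \<le> total_cost k T s"
  using assms sum_bounded_below[of "{1..k}" "server_cost T s L" "server_cost T s"]
  by (simp add: min_server_def total_cost_def)

section \<open>Logarithmic estimates for \<beta>\<close>

text \<open>The inequality \<open>ln x \<le> x - 1\<close> at the reciprocal of the base. This is
  the source of the factor 1/\<epsilon> in the asymptotic bounds.\<close>

lemma ln_swap_base_ge: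
  fixes \<epsilon> :: real
  assumes "\<epsilon> > 0"
  shows "\<epsilon> / (2 + 2 * \<epsilon>) \<le> ln ((2 + 2 * \<epsilon>) / (2 + \<epsilon>))"
proof -
  have "ln ((2 + \<epsilon>) / (2 + 2 * \<epsilon>)) \<le> (2 + \<epsilon>) / (2 + 2 * \<epsilon>) - 1"
    using assms by (intro ln_le_minus_one) auto
  moreover have "ln ((2 + \<epsilon>) / (2 + 2 * \<epsilon>)) = - ln ((2 + 2 * \<epsilon>) / (2 + \<epsilon>))"
    using assms by (simp add: ln_div)
  moreover have "(2 + \<epsilon>) / (2 + 2 * \<epsilon>) - 1 = - (\<epsilon> / (2 + 2 * \<epsilon>))"
    using assms by (simp add: field_simps)
  ultimately show ?thesis by linarith
qed

lemma log_swap_base_le: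
  fixes \<epsilon> x :: real
  assumes "\<epsilon> > 0" "x \<ge> 1"
  shows "log ((2 + 2 * \<epsilon>) / (2 + \<epsilon>)) x \<le> ln x * ((2 + 2 * \<epsilon>) / \<epsilon>)"
proof -
  have pos: "0 < \<epsilon> / (2 + 2 * \<epsilon>)" using assms by simp
  then have "ln x / ln ((2 + 2 * \<epsilon>) / (2 + \<epsilon>)) \<le> ln x / (\<epsilon> / (2 + 2 * \<epsilon>))"
    using ln_swap_base_ge[OF assms(1)] assms(2)
    by (intro divide_left_mono mult_pos_pos) auto
  then show ?thesis by (simp add: log_def)
qed

text \<open>For \<open>n \<ge> 2\<close>, \<open>ln (real n)\<close> is at least 1/2 and absorbs the
  summand 3/2; at \<open>n = 1\<close> it vanishes although \<beta> need not. The cap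
  \<open>\<epsilon>\<^sub>0\<close> is there because, for large \<open>e\<close>, \<beta> grows with
  \<open>e\<close> while \<open>1 / e\<close> decays.\<close>

lemma swap_beta_le:
  fixes \<epsilon>\<^sub>0 e D :: real
  assumes "n \<ge> 2" "0 < e" "e \<le> \<epsilon>\<^sub>0" "0 \<le> D"
  shows "swap_beta e n D \<le> 2 * (1 + \<epsilon>\<^sub>0) * (2 + 5 * \<epsilon>\<^sub>0) * (ln (real n) * D / e)"
proof -
  have "1 / 2 \<le> ln (2::real)" using ln_le_minus_one[of "1/2::real"] by (simp add: ln_div)
  also have "\<dots> \<le> ln (real n)" using assms by simp
  finally have ln: "1 / 2 \<le> ln (real n)" .
  have "3 / 2 * e \<le> (3 * ln (real n)) * \<epsilon>\<^sub>0"
    using ln assms by (intro mult_mono) auto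
  then have "3 / 2 \<le> 3 * \<epsilon>\<^sub>0 * ln (real n) / e"
    using assms by (simp add: field_simps)
  moreover have "log ((2 + 2 * e) / (2 + e)) (real n) \<le> ln (real n) * (2 + 2 * \<epsilon>\<^sub>0) / e"
  proof -
    have "ln (real n) * ((2 + 2 * e) / e) \<le> ln (real n) * ((2 + 2 * \<epsilon>\<^sub>0) / e)"
      using ln assms by (intro mult_left_mono divide_right_mono) auto
    then show ?thesis using log_swap_base_le[of e "real n"] assms by simp
  qed
  ultimately have "3 / 2 + log ((2 + 2 * e) / (2 + e)) (real n)
      \<le> 3 * \<epsilon>\<^sub>0 * ln (real n) / e + ln (real n) * (2 + 2 * \<epsilon>\<^sub>0) / e" by linarith
  also have "\<dots> = (2 + 5 * \<epsilon>\<^sub>0) * (ln (real n) / e)"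
    by (simp add: algebra_simps add_divide_distrib)
  finally have bound: "3 / 2 + log ((2 + 2 * e) / (2 + e)) (real n) \<le> (2 + 5 * \<epsilon>\<^sub>0) * (ln (real n) / e)" .
  have "swap_beta e n D \<le> 2 * (1 + e) * D * ((2 + 5 * \<epsilon>\<^sub>0) * (ln (real n) / e))"
    unfolding swap_beta_def using bound assms by (intro mult_left_mono) auto
  also have "\<dots> \<le> 2 * (1 + \<epsilon>\<^sub>0) * D * ((2 + 5 * \<epsilon>\<^sub>0) * (ln (real n) / e))"
    using ln assms by (intro mult_right_mono) auto
  finally show ?thesis by (simp add: mult_ac)
qed

section \<open>Constants of the procedure and the stopping threshold\<close>

locale swapping =
  fixes k T :: nat and p \<sigma> :: "nat \<Rightarrow> 'a::metric_space" and \<epsilon> w D :: real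
  assumes bounded_UNIV: "bounded (UNIV :: 'a set)"
    and k_pos: "k \<ge> 1"
    and eps_pos: "\<epsilon> > 0"
    and w_nonneg: "w \<ge> 0"
    and D_def: "D = diameter (UNIV :: 'a set)"
begin

text \<open>\<open>1 / r\<close> is the mean of 1 and \<open>1 / (1 + \<epsilon>)\<close>.\<close>

definition r :: real where "r = (2 + 2 * \<epsilon>) / (2 + \<epsilon>)"
definition N :: real where "N = log r (real k)"
definition B :: real where "B = real k / (1 + \<epsilon>)"
definition \<theta> :: real where "\<theta> = (1 + \<epsilon>) * w / real k + swap_beta \<epsilon> k D"

lemma dist_le_D: "dist (x::'a) y \<le> D"
  unfolding D_def using diameter_bounded_bound[OF bounded_UNIV] by simp

lemma D_nonneg: "0 \<le> D"
  using dist_le_D[of undefined undefined] by simp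

lemma r_gt_1: "1 < r"
  using eps_pos by (simp add: r_def field_simps)

lemma r_le: "r \<le> 1 + \<epsilon>"
  using eps_pos by (simp add: r_def field_simps)

lemma N_nonneg: "0 \<le> N"
  using r_gt_1 k_pos by (simp add: N_def)

lemma B_pos: "0 < B"
  using eps_pos k_pos by (simp add: B_def)

lemma B_le: "B \<le> real k"
  using eps_pos k_pos by (simp add: B_def field_simps)

text \<open>Here \<open>w / real k + 2 * D * N\<close> bounds the average cost within
  \<open>k * N\<close> swaps, and \<open>3 * D\<close> is twice the amount by which a swapped server
  may exceed the mean of its pair.\<close>

lemma \<theta>_eq: "\<theta> = (1 + \<epsilon>) * (w / real k + 2 * D * N + 3 * D)"
  by (simp add: \<theta>_def swap_beta_def N_def r_def algebra_simps)

lemma \<theta>_nonneg: "0 \<le> \<theta>"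
  unfolding \<theta>_eq using eps_pos w_nonneg D_nonneg N_nonneg by simp

text \<open>Caps the ratio of \<open>w\<close> to \<theta>, hence the number of levels
  \<open>w / r ^ j\<close> above \<theta>.\<close>

lemma w_le_\<theta>: "(1 + \<epsilon>) * w \<le> real k * \<theta>"
proof -
  have "0 \<le> (1 + \<epsilon>) * (2 * D * N + 3 * D)"
    using eps_pos D_nonneg N_nonneg by simp
  then have "(1 + \<epsilon>) * w / real k \<le> \<theta>"
    unfolding \<theta>_eq by (simp add: algebra_simps)
  then show ?thesis using k_pos by (simp add: field_simps)
qed

lemma swap_needed_iff:
  fixes s :: "nat \<Rightarrow> nat \<Rightarrow> 'a"
  assumes "max_server k T s H"
  shows "swap_needed k T \<epsilon> w s \<longleftrightarrow> \<theta> < server_cost T s H"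
  unfolding swap_needed_def server_cost_max_server[OF assms] \<theta>_def D_def[symmetric] ..

section \<open>Effect of an exchange on costs, and existence of a balancing time\<close>

lemma server_cost_exchange_le:
  fixes s :: "nat \<Rightarrow> nat \<Rightarrow> 'a"
  assumes "z \<le> T" "H \<noteq> L"
  shows "server_cost T (exchange s H L z) H \<le> exchanged_cost T s H L z + D"
proof -
  let ?e = "exchange s H L z"
  have before: "(\<Sum>t=1..z. step_cost ?e H t) = (\<Sum>t=1..z. step_cost s H t)"
    using assms by (intro sum.cong) (auto simp: step_cost_def exchange_def)
  \<comment> \<open>Only the move at \<open>z + 1\<close> differs from a move of \<open>L\<close>;
    \<open>D\<close> is charged for it on top of the cost of \<open>L\<close>. For
    \<open>z = T\<close> there is no such move.\<close>
  have "(\<Sum>t=z+1..T. step_cost ?e H t)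
      \<le> (\<Sum>t=z+1..T. step_cost s L t + (if t = z + 1 then D else 0))"
  proof (rule sum_mono)
    fix t assume "t \<in> {z+1..T}"
    then consider "t = z + 1" | "t > z + 1" by force
    then show "step_cost ?e H t \<le> step_cost s L t + (if t = z + 1 then D else 0)"
    proof cases
      case 1
      then show ?thesis using step_cost_nonneg[of s L t] dist_le_D[of "?e H (t - 1)" "?e H t"]
        unfolding step_cost_def[of ?e] by simp
    next
      case 2
      then show ?thesis using assms by (auto simp: step_cost_def exchange_def)
    qed
  qed
  also have "\<dots> \<le> (\<Sum>t=z+1..T. step_cost s L t) + D"
    using D_nonneg by (simp add: sum.distrib)
  finally show ?thesis
    unfolding exchanged_cost_def server_cost_def
    using before sum_split_at[OF assms(1), of "step_cost ?e H"] by linarith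
qed

text \<open>The exchanged costs of the pair have the old sum, and each of the two servers pays at
  most one penalty \<open>D\<close>.\<close>

lemma total_cost_exchange_le:
  fixes s :: "nat \<Rightarrow> nat \<Rightarrow> 'a"
  assumes "z \<le> T" "H \<noteq> L" "H \<in> {1..k}" "L \<in> {1..k}"
  shows "total_cost k T (exchange s H L z) \<le> total_cost k T s + 2 * D"
proof -
  let ?e = "exchange s H L z" and ?R = "{1..k} - {H} - {L}"
  have split: "total_cost k T f = server_cost T f H + server_cost T f L + (\<Sum>i\<in>?R. server_cost T f i)"
    for f :: "nat \<Rightarrow> nat \<Rightarrow> 'a"
    using assms sum.remove[of "{1..k}" H "server_cost T f"]
      sum.remove[of "{1..k} - {H}" L "server_cost T f"]
    unfolding total_cost_def by simp
  have rest: "(\<Sum>i\<in>?R. server_cost T ?e i) = (\<Sum>i\<in>?R. server_cost T s i)"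
    by (intro sum.cong) (auto simp: server_cost_exchange_other)
  have "server_cost T ?e H + server_cost T ?e L \<le> server_cost T s H + server_cost T s L + 2 * D"
    using server_cost_exchange_le[of z H L s] server_cost_exchange_le[of z L H s]
      exchanged_cost_add[of z T s H L] exchange_commute[of s H L z] assms by simp
  then show ?thesis using split[of ?e] split[of s] rest by linarith
qed

text \<open>Two numbers with difference at most \<open>D\<close> are at most \<open>D / 2\<close>
  above their mean; the penalty adds another \<open>D\<close>.\<close>

lemma server_cost_exchange_balanced:
  fixes s :: "nat \<Rightarrow> nat \<Rightarrow> 'a"
  assumes "balancing_time T s H L z" "H \<noteq> L" "i \<in> {H, L}"
  shows "server_cost T (exchange s H L z) i
    \<le> (server_cost T s H + server_cost T s L) / 2 + 3 / 2 * D"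
proof -
  have z: "z \<le> T" and bal: "\<bar>exchanged_cost T s H L z - exchanged_cost T s L H z\<bar> \<le> D"
    using assms by (auto simp: balancing_time_def D_def)
  have "server_cost T (exchange s H L z) H \<le> exchanged_cost T s H L z + D"
    "server_cost T (exchange s H L z) L \<le> exchanged_cost T s L H z + D"
    using server_cost_exchange_le[OF z, of H L s] server_cost_exchange_le[OF z, of L H s] assms(2)
    by (simp_all add: exchange_commute[of s L H])
  then have "\<forall>i\<in>{H, L}. server_cost T (exchange s H L z) i
      \<le> (server_cost T s H + server_cost T s L) / 2 + 3 / 2 * D"
    using bal exchanged_cost_add[OF z, of s H L] by (simp add: abs_le_iff field_simps)
  then show ?thesis using assms(3) by blast
qed

text \<open>
  As a function of \<open>z\<close>, the difference of the exchanged costs runs from \<open>-\<delta> \<le> 0\<close> at \<open>0\<close> to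
  \<open>\<delta>\<close> at \<open>T\<close> in steps of size at most \<open>2D\<close>, so it meets \<open>[-D, D]\<close>; if it does so at
  \<open>0\<close>, then also at \<open>T\<close>.
\<close>

lemma balancing_time_exists:
  fixes s :: "nat \<Rightarrow> nat \<Rightarrow> 'a"
  assumes "swap_needed k T \<epsilon> w s" and H: "max_server k T s H" and L: "min_server k T s L"
  shows "\<exists>z. balancing_time T s H L z"
proof -
  define f where "f z = exchanged_cost T s H L z - exchanged_cost T s L H z" for z
  have le: "server_cost T s L \<le> server_cost T s H"
    using H L by (auto simp: max_server_def min_server_def)
  have "0 < server_cost T s H"
    using assms(1) swap_needed_iff[OF H] \<theta>_nonneg by simp
  then have T: "T \<ge> 1" by (cases "T = 0") (auto simp: server_cost_def)
  have f0: "f 0 = server_cost T s L - server_cost T s H"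
    by (simp add: f_def exchanged_cost_def server_cost_def)
  have fT: "f T = server_cost T s H - server_cost T s L"
    by (simp add: f_def exchanged_cost_def server_cost_def)
  define z where "z = (LEAST z. 0 \<le> f z)"
  have z: "0 \<le> f z" "z \<le> T"
    using fT le unfolding z_def by (auto intro: LeastI[of _ T] Least_le)
  have goalI: "\<exists>z. balancing_time T s H L z" if "y \<le> T" "\<bar>f y\<bar> \<le> D" for y
  proof (cases "y = 0")
    case True
    then have "\<bar>f T\<bar> \<le> D" using that(2) f0 fT by simp
    then show ?thesis using T by (auto simp: balancing_time_def f_def D_def)
  next
    case False
    then show ?thesis using that by (auto simp: balancing_time_def f_def D_def intro!: exI[of _ y])
  qed
  show ?thesis
  proof (cases z)
    case 0
    then have "f 0 = 0" using z f0 le by simp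
    then show ?thesis using goalI[of 0] D_nonneg by simp
  next
    case (Suc y)
    then have neg: "f y < 0" using not_less_Least[of y "\<lambda>z. 0 \<le> f z"] unfolding z_def by auto
    have tail: "(\<Sum>t=y+1..T. step_cost s i t) = step_cost s i z + (\<Sum>t=z+1..T. step_cost s i t)" for i
      using Suc z by (simp add: sum.atLeast_Suc_atMost)
    have head: "(\<Sum>t=1..z. step_cost s i t) = (\<Sum>t=1..y. step_cost s i t) + step_cost s i z" for i
      using Suc by simp
    \<comment> \<open>A step of \<open>H\<close> enters one exchanged cost and leaves the other, and
      conversely for \<open>L\<close>; hence the factor 2.\<close>
    have "f z = f y + 2 * (step_cost s H z - step_cost s L z)"
      unfolding f_def exchanged_cost_def tail head by simp
    moreover have "step_cost s H z \<le> D" unfolding step_cost_def by (rule dist_le_D)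
    ultimately have "f z \<le> f y + 2 * D" using step_cost_nonneg[of s L z] by simp
    then have "\<bar>f z\<bar> \<le> D \<or> \<bar>f y\<bar> \<le> D" using neg z by linarith
    then show ?thesis using goalI[of z] goalI[of y] Suc z by auto
  qed
qed

lemma swap_step_exists:
  fixes s :: "nat \<Rightarrow> nat \<Rightarrow> 'a"
  assumes "swap_needed k T \<epsilon> w s"
  shows "\<exists>s'. swap_step k T \<epsilon> w s s'"
  using max_server_exists[OF k_pos, of T s] min_server_exists[OF k_pos, of T s]
    balancing_time_exists[OF assms] assms unfolding swap_step_def by blast

section \<open>The invariant and its preservation\<close>

text \<open>The upper end \<open>w / r ^ j\<close> of the range is left to the invariant, which
  imposes it on all servers. The condition on \<theta> is what allows the averaging in
  \<open>card_heavy_le\<close>.\<close>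

definition heavy :: "(nat \<Rightarrow> nat \<Rightarrow> 'a) \<Rightarrow> nat \<Rightarrow> nat set" where
  "heavy s j = {i\<in>{1..k}. \<theta> < server_cost T s i \<and> w / r ^ Suc j < server_cost T s i}"

text \<open>Each range has a budget of \<open>B\<close> swaps; what is left of it in range \<open>j\<close> pays for \<open>heavy s j\<close>.\<close>

definition after_swaps :: "nat \<Rightarrow> (nat \<Rightarrow> nat \<Rightarrow> 'a) \<Rightarrow> bool" where
  "after_swaps n s \<longleftrightarrow> solution k T p \<sigma> s \<and> total_cost k T s \<le> w + 2 * D * real n \<and> real n \<le> B * N \<and>
     (\<exists>j. (\<forall>i\<in>{1..k}. server_cost T s i \<le> w / r ^ j) \<and>
          real n + real (card (heavy s j)) \<le> B * real (Suc j))"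

lemma finite_heavy: "finite (heavy s j)"
  by (simp add: heavy_def)

text \<open>Each heavy server exceeds \<theta>, whereas the total cost is at most
  \<open>B * \<theta>\<close>: the factor \<open>1 + \<epsilon>\<close> of \<theta> cancels the one
  in \<open>B\<close>.\<close>

lemma card_heavy_le:
  assumes "total_cost k T s \<le> w + 2 * D * real n" "real n \<le> B * N"
  shows "real (card (heavy s j)) \<le> B"
proof (cases "heavy s j = {}")
  case True
  then show ?thesis using B_pos by simp
next
  case False
  have "B * N \<le> real k * N" using B_le N_nonneg by (rule mult_right_mono)
  then have "2 * D * real n \<le> 2 * D * (real k * N)"
    using assms(2) D_nonneg by (intro mult_left_mono) auto
  also have "\<dots> \<le> real k * (2 * D * N + 3 * D)"
    using D_nonneg by (simp add: algebra_simps)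
  finally have "w + 2 * D * real n \<le> w + real k * (2 * D * N + 3 * D)" by simp
  also have "\<dots> = real k * (w / real k + 2 * D * N + 3 * D)"
    using k_pos by (simp add: algebra_simps)
  also have "\<dots> = B * \<theta>"
    using eps_pos by (simp add: B_def \<theta>_eq)
  finally have "w + 2 * D * real n \<le> B * \<theta>" .
  moreover have "(\<Sum>i\<in>heavy s j. \<theta>) < (\<Sum>i\<in>heavy s j. server_cost T s i)"
    by (rule sum_strict_mono[OF finite_heavy False]) (simp add: heavy_def)
  moreover have "(\<Sum>i\<in>heavy s j. server_cost T s i) \<le> total_cost k T s"
    unfolding total_cost_def by (intro sum_mono2) (auto simp: heavy_def server_cost_nonneg)
  ultimately have "(\<Sum>i\<in>heavy s j. \<theta>) < B * \<theta>" using assms(1) by linarith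
  then have "real (card (heavy s j)) * \<theta> < B * \<theta>" by simp
  then have "real (card (heavy s j)) < B" using \<theta>_nonneg by (rule mult_right_less_imp_less)
  then show ?thesis by (rule less_imp_le)
qed

lemma after_swaps_0:
  assumes "solution k T p \<sigma> s" "total_cost k T s = w"
  shows "after_swaps 0 s"
proof -
  have "server_cost T s i \<le> w" if "i \<in> {1..k}" for i
    using that assms(2) member_le_sum[of i "{1..k}" "server_cost T s"]
    by (simp add: total_cost_def server_cost_nonneg)
  moreover have "0 \<le> B * N" using B_pos N_nonneg by simp
  moreover from this have "real (card (heavy s 0)) \<le> B"
    using card_heavy_le[of s 0 0] assms(2) by simp
  ultimately show ?thesis
    using assms unfolding after_swaps_def by (auto intro!: exI[of _ 0])
qed

text \<open>\<open>L\<close> costs at most the average, so \<theta> makes its cost plus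
  \<open>3 * D\<close> at most \<open>1 / (1 + \<epsilon>)\<close> times that of \<open>H\<close>.
  Taking the mean with \<open>H\<close> gives the factor \<open>1 / r\<close>.\<close>

lemma swap_step_shrinks:
  assumes inv: "total_cost k T s \<le> w + 2 * D * real n" "real n \<le> B * N"
    and H: "max_server k T s H" and L: "min_server k T s L"
    and big: "\<theta> < server_cost T s H"
  shows "(server_cost T s H + server_cost T s L) / 2 + 3 / 2 * D \<le> server_cost T s H / r"
    and "H \<noteq> L"
proof -
  let ?h = "server_cost T s H" and ?l = "server_cost T s L"
  have "B * N \<le> real k * N" using B_le N_nonneg by (rule mult_right_mono)
  then have "2 * D * real n \<le> 2 * D * (real k * N)"
    using inv(2) D_nonneg by (intro mult_left_mono) auto
  then have "real k * ?l \<le> w + 2 * D * (real k * N)"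
    using k_times_min_server_le[OF L] inv(1) by linarith
  then have "?l \<le> w / real k + 2 * D * N"
    using k_pos by (simp add: field_simps)
  then have "(1 + \<epsilon>) * (?l + 3 * D) \<le> \<theta>"
    unfolding \<theta>_eq using eps_pos by (intro mult_left_mono) auto
  then have key: "(1 + \<epsilon>) * (?l + 3 * D) < ?h" using big by linarith
  then have "?l + 3 * D \<le> ?h / (1 + \<epsilon>)"
    using eps_pos by (simp add: field_simps)
  then have "(?h + (?l + 3 * D)) / 2 \<le> (?h + ?h / (1 + \<epsilon>)) / 2"
    by (intro divide_right_mono add_left_mono) auto
  also have "\<dots> = ?h / r"
    using eps_pos by (simp add: r_def field_simps)
  finally show "(?h + ?l) / 2 + 3 / 2 * D \<le> ?h / r"
    by (simp add: add_divide_distrib)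
  have "?l \<le> ?l + 3 * D" using D_nonneg by simp
  also have "\<dots> \<le> (1 + \<epsilon>) * (?l + 3 * D)"
    using mult_right_mono[of 1 "1 + \<epsilon>" "?l + 3 * D"] eps_pos server_cost_nonneg[of T s L] D_nonneg
    by simp
  finally have "?l < ?h" using key by (rule le_less_trans)
  then show "H \<noteq> L" by auto
qed

text \<open>If \<open>H\<close> is in range \<open>j\<close>, the swap trades a heavy server for one
  unit of the count. Otherwise all servers have left that range, and the next one brings a fresh
  budget \<open>B\<close>.\<close>

lemma after_swaps_Suc:
  assumes inv: "after_swaps n s" and step: "swap_step k T \<epsilon> w s s'"
  shows "after_swaps (Suc n) s'"
proof -
  from inv have sol: "solution k T p \<sigma> s" and tot: "total_cost k T s \<le> w + 2 * D * real n"
    and n: "real n \<le> B * N" by (auto simp: after_swaps_def)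
  from step obtain H L z where H: "max_server k T s H" and L: "min_server k T s L"
    and z: "balancing_time T s H L z" and s': "s' = exchange s H L z" and "swap_needed k T \<epsilon> w s"
    by (auto simp: swap_step_def)
  then have big: "\<theta> < server_cost T s H" using swap_needed_iff by blast
  let ?h = "server_cost T s H"
  have range: "H \<in> {1..k}" "L \<in> {1..k}" "z \<le> T"
    using H L z by (auto simp: max_server_def min_server_def balancing_time_def)
  note shrink = swap_step_shrinks[OF tot n H L big]
  have new: "server_cost T s' i \<le> ?h / r" if "i \<in> {H, L}" for i
    using server_cost_exchange_balanced[OF z shrink(2) that] shrink(1) s' by simp
  have old: "server_cost T s' i = server_cost T s i" if "i \<notin> {H, L}" for i
    using that s' server_cost_exchange_other by auto
  have h_pos: "0 < ?h" using big \<theta>_nonneg by linarith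
  have new_j: "server_cost T s' i \<le> w / r ^ Suc j" if "i \<in> {H, L}" "?h \<le> w / r ^ j" for i j
    using new[OF that(1)] divide_right_mono[OF that(2), of r] r_gt_1 by (simp add: mult.commute)
  \<comment> \<open>Both swapped servers fall to \<open>w / r ^ Suc j\<close> or lower and the
    others keep their cost, so \<open>H\<close> leaves and nobody enters.\<close>
  have heavy: "real (Suc n) + real (card (heavy s' j)) \<le> B * real (Suc j)"
    if "?h \<le> w / r ^ j" "H \<in> heavy s j" "real n + real (card (heavy s j)) \<le> B * real (Suc j)" for j
  proof -
    have "heavy s' j \<subseteq> heavy s j - {H}"
    proof
      fix i assume i: "i \<in> heavy s' j"
      then have "i \<notin> {H, L}" using new_j[OF _ that(1), of i] unfolding heavy_def by force
      then show "i \<in> heavy s j - {H}" using i old[of i] unfolding heavy_def by auto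
    qed
    then have "card (heavy s' j) \<le> card (heavy s j) - 1"
      using card_mono[of "heavy s j - {H}" "heavy s' j"] finite_heavy that(2) by simp
    moreover have "card (heavy s j) > 0"
      using that(2) finite_heavy card_gt_0_iff by blast
    ultimately show ?thesis using that(3) by linarith
  qed
  \<comment> \<open>The maximum does not rise, so nobody climbs above a level that \<open>H\<close>
    respects.\<close>
  have light: "heavy s' j = {}" if "?h \<le> w / r ^ Suc j" for j
  proof -
    have "?h / r \<le> ?h" using h_pos r_gt_1 by (simp add: field_simps)
    then have "server_cost T s' i \<le> ?h" if "i \<in> {1..k}" for i
      using new[of i] old[of i] H that by (cases "i \<in> {H, L}") (auto simp: max_server_def)
    then show ?thesis using that unfolding heavy_def by force
  qed
  obtain j where j: "\<forall>i\<in>{1..k}. server_cost T s i \<le> w / r ^ j"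
      "real (Suc n) + real (card (heavy s' j)) \<le> B * real (Suc j)"
  proof -
    from inv obtain j where j: "\<forall>i\<in>{1..k}. server_cost T s i \<le> w / r ^ j"
        "real n + real (card (heavy s j)) \<le> B * real (Suc j)" by (auto simp: after_swaps_def)
    show thesis
    proof (cases "H \<in> heavy s j")
      case True
      then show thesis using that[of j] heavy[of j] j range by blast
    next
      case False
      then have h: "?h \<le> w / r ^ Suc j" using big range by (auto simp: heavy_def)
      then have all: "\<forall>i\<in>{1..k}. server_cost T s i \<le> w / r ^ Suc j"
        using H by (force simp: max_server_def)
      have card: "real (card (heavy s i)) \<le> B" for i using card_heavy_le[OF tot n] .
      have n_le: "real n \<le> B * real (Suc j)" using j(2) by linarith
      have Suc_Suc: "B * real (Suc (Suc j)) = B * real (Suc j) + B" by (simp add: algebra_simps)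
      have next_j: "real n + real (card (heavy s (Suc j))) \<le> B * real (Suc (Suc j))"
        unfolding Suc_Suc using n_le card by (rule add_mono)
      show thesis
      proof (cases "H \<in> heavy s (Suc j)")
        case True
        then show thesis using that[of "Suc j"] heavy[OF h] all next_j by blast
      next
        case False
        \<comment> \<open>\<open>H\<close> is below range \<open>Suc j\<close> too, so the fresh
          budget has to pay only for the swap itself. This needs \<open>1 \<le> B\<close>, which
          fails when \<open>\<epsilon> > k - 1\<close>. But \<open>w / r ^ i\<close> tends to 0, so
          \<open>H\<close> is heavy for some \<open>i\<close>, and a heavy set has at most
          \<open>B\<close> members.\<close>
        then have "heavy s' (Suc j) = {}" using big range light[of "Suc j"] by (auto simp: heavy_def)
        moreover have "1 \<le> B"
        proof -
          obtain i where "w / r ^ Suc i < ?h"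
          proof -
            obtain i where "w / ?h < r ^ i" using real_arch_pow[OF r_gt_1] by blast
            also have "r ^ i \<le> r ^ Suc i" using r_gt_1 by simp
            finally have "w / r ^ Suc i < ?h"
              using h_pos r_gt_1 by (simp add: field_simps)
            then show thesis using that by blast
          qed
          then have "H \<in> heavy s i" using big range by (simp add: heavy_def)
          then have "1 \<le> card (heavy s i)"
            using finite_heavy card_gt_0_iff[of "heavy s i"] by (simp add: Suc_le_eq) blast
          then show ?thesis using card[of i] by linarith
        qed
        ultimately have "real (Suc n) + real (card (heavy s' (Suc j))) \<le> B * real (Suc (Suc j))"
          unfolding Suc_Suc using n_le by simp
        then show thesis using that[of "Suc j"] all by blast
      qed
    qed
  qed
  have h_le: "?h \<le> w / r ^ j" using j(1) range by blast
  have rj: "0 < r ^ j" using r_gt_1 by simp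
  have "0 < w / r ^ j" using h_pos h_le by linarith
  then have w_pos: "0 < w" using r_gt_1 by (simp add: zero_less_divide_iff)
  \<comment> \<open>From here to \<open>Suc j < N\<close>: a maximum above \<theta> forces
    \<open>(1 + \<epsilon>) * r ^ j < k\<close>, and \<open>r \<le> 1 + \<epsilon>\<close> gains the
    extra power of \<open>r\<close>. The budget used so far thus stays below
    \<open>B * N\<close>.\<close>
  have "real k * \<theta> < real k * (w / r ^ j)"
    using big h_le k_pos by (intro mult_strict_left_mono) auto
  with w_le_\<theta> have "(1 + \<epsilon>) * w < real k * (w / r ^ j)" by (rule le_less_trans)
  then have "w * ((1 + \<epsilon>) * r ^ j) < w * real k"
    using rj by (simp add: field_simps)
  then have "(1 + \<epsilon>) * r ^ j < real k"
    using w_pos by (simp only: mult_less_cancel_left_pos)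
  moreover have "r ^ Suc j \<le> (1 + \<epsilon>) * r ^ j" using r_le rj by simp
  ultimately have "r ^ Suc j < real k" by linarith
  then have "real (Suc j) < N"
    unfolding N_def using r_gt_1 k_pos by (simp only: less_log_of_power)
  then have "B * real (Suc j) \<le> B * N" using B_pos by simp
  then have "real (Suc n) \<le> B * N" using j(2) by linarith
  moreover have "\<forall>i\<in>{1..k}. server_cost T s' i \<le> w / r ^ j"
  proof
    fix i assume i: "i \<in> {1..k}"
    have "w / r ^ Suc j \<le> w / r ^ j"
      using w_nonneg r_gt_1 by (intro divide_left_mono) auto
    then show "server_cost T s' i \<le> w / r ^ j"
      using new_j[OF _ h_le, of i] old[of i] j(1) i by (cases "i \<in> {H, L}") force+
  qed
  moreover have "total_cost k T s' \<le> w + 2 * D * real (Suc n)"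
    using total_cost_exchange_le[OF range(3) shrink(2) range(1,2), of s] tot s'
    by (simp add: algebra_simps)
  moreover have "solution k T p \<sigma> s'"
    using solution_exchange[OF sol range(1,2)] s' by simp
  ultimately show ?thesis using j(2) unfolding after_swaps_def by blast
qed

section \<open>Termination and the guarantees for the result\<close>

lemma after_swaps_relpowp:
  assumes "after_swaps 0 s" "(swap_step k T \<epsilon> w ^^ n) s s'"
  shows "after_swaps n s'"
  using assms(2)
proof (induction n arbitrary: s')
  case 0
  then show ?case using assms(1) by simp
next
  case (Suc n)
  then show ?case using after_swaps_Suc by auto
qed

text \<open>The invariant contains \<open>real n \<le> B * N\<close>, which fails for large
  \<open>n\<close>.\<close>

lemma no_infinite_run:
  assumes "after_swaps 0 s"
  shows "\<not> (\<exists>run. run 0 = s \<and> (\<forall>n. swap_step k T \<epsilon> w (run n) (run (Suc n))))"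
proof
  assume "\<exists>run. run 0 = s \<and> (\<forall>n. swap_step k T \<epsilon> w (run n) (run (Suc n)))"
  then obtain run where run: "run 0 = s" "\<And>n. swap_step k T \<epsilon> w (run n) (run (Suc n))" by blast
  have "after_swaps n (run n)" for n
    by (induction n) (use assms run after_swaps_Suc in auto)
  then have "real n \<le> B * N" for n by (auto simp: after_swaps_def)
  then show False using reals_Archimedean2[of "B * N"] by (auto simp: not_less[symmetric])
qed

text \<open>If nothing is returned, every reachable family admits a further swap, and dependent
  choice yields an infinite run.\<close>

lemma swapping_returns_exists:
  assumes "after_swaps 0 s"
  shows "\<exists>s'. swapping_returns k T \<epsilon> w s s'"
proof (rule ccontr)
  assume none: "\<nexists>s'. swapping_returns k T \<epsilon> w s s'"
  \<comment> \<open>The clause for \<open>n = 0\<close> pins the start of the chosen run to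
    \<open>s\<close>.\<close>
  have "\<exists>run. \<forall>n::nat. ((swap_step k T \<epsilon> w)\<^sup>*\<^sup>* s (run n) \<and> (n = 0 \<longrightarrow> run n = s)) \<and>
      swap_step k T \<epsilon> w (run n) (run (Suc n))"
  proof (rule dependent_nat_choice)
    show "\<exists>x. (swap_step k T \<epsilon> w)\<^sup>*\<^sup>* s x \<and> ((0::nat) = 0 \<longrightarrow> x = s)" by blast
  next
    fix x and n :: nat assume "(swap_step k T \<epsilon> w)\<^sup>*\<^sup>* s x \<and> (n = 0 \<longrightarrow> x = s)"
    then show "\<exists>y. ((swap_step k T \<epsilon> w)\<^sup>*\<^sup>* s y \<and> (Suc n = 0 \<longrightarrow> y = s)) \<and> swap_step k T \<epsilon> w x y"
      using none swap_step_exists[of x] unfolding swapping_returns_def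
      by (metis nat.distinct(1) rtranclp.rtrancl_into_rtrancl)
  qed
  then show False using no_infinite_run[OF assms] by blast
qed

text \<open>At most \<open>B * N\<close> swaps cost \<open>2 * D\<close> each. The
  \<open>1 + \<epsilon>\<close> in the bound on \<open>N\<close> cancels against \<open>B\<close>,
  so the constant does not depend on \<epsilon>; the calculation reaches 4 before relaxing to
  8.\<close>

lemma total_cost_after_swaps:
  assumes "after_swaps n s"
  shows "total_cost k T s \<le> w + 8 * (real k * ln (real k) * D / \<epsilon>)"
proof -
  have "2 * D * real n \<le> 2 * D * (B * N)"
    using assms D_nonneg by (intro mult_left_mono) (auto simp: after_swaps_def)
  also have "\<dots> \<le> 2 * D * (B * (ln (real k) * ((2 + 2 * \<epsilon>) / \<epsilon>)))"
    using log_swap_base_le[OF eps_pos, of "real k"] k_pos B_pos D_nonneg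
    unfolding N_def r_def by (intro mult_left_mono) auto
  also have "\<dots> = 4 * (real k * ln (real k) * D / \<epsilon>)"
  proof -
    have "B * (1 + \<epsilon>) = real k" using eps_pos by (simp add: B_def)
    moreover have "B * ((2 + 2 * \<epsilon>) / \<epsilon>) = 2 * (B * (1 + \<epsilon>)) / \<epsilon>"
      by (simp add: algebra_simps)
    ultimately have "B * ((2 + 2 * \<epsilon>) / \<epsilon>) = 2 * real k / \<epsilon>" by simp
    then have "2 * D * (ln (real k) * (B * ((2 + 2 * \<epsilon>) / \<epsilon>))) = 4 * (real k * ln (real k) * D / \<epsilon>)"
      by (simp only:) (simp add: mult_ac)
    then show ?thesis by (simp only: mult.left_commute)
  qed
  also have "\<dots> \<le> 8 * (real k * ln (real k) * D / \<epsilon>)"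
    using k_pos D_nonneg eps_pos by (intro mult_right_mono) auto
  finally show ?thesis using assms by (auto simp: after_swaps_def)
qed

lemma fair_if_not_swap_needed:
  fixes s :: "nat \<Rightarrow> nat \<Rightarrow> 'a"
  assumes "\<not> swap_needed k T \<epsilon> w s"
  shows "fair k T (1 + \<epsilon>) (swap_beta \<epsilon> k D) w s"
  using assms k_pos by (auto simp: swap_needed_def fair_def D_def not_less)

end

theorem theorem8:
  fixes k T :: nat and p \<sigma> :: "nat \<Rightarrow> 'a::metric_space" and s :: "nat \<Rightarrow> nat \<Rightarrow> 'a"
    and \<epsilon> :: real
  assumes "bounded (UNIV :: 'a set)"
    and "k \<ge> 1"
    and "solution k T p \<sigma> s"
    and "total_cost k T s = opt_cost k T p \<sigma>"
    and "\<epsilon> > 0"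
  shows "(\<not> (\<exists>run. run 0 = s \<and> (\<forall>n. swap_step k T \<epsilon> (opt_cost k T p \<sigma>) (run n) (run (Suc n)))))
     \<and> (\<forall>s' H L. (swap_step k T \<epsilon> (opt_cost k T p \<sigma>))\<^sup>*\<^sup>* s s' \<longrightarrow>
           swap_needed k T \<epsilon> (opt_cost k T p \<sigma>) s' \<longrightarrow>
           max_server k T s' H \<longrightarrow> min_server k T s' L \<longrightarrow> (\<exists>z. balancing_time T s' H L z))
     \<and> (\<exists>s'. swapping_returns k T \<epsilon> (opt_cost k T p \<sigma>) s s')
     \<and> (\<forall>s'. swapping_returns k T \<epsilon> (opt_cost k T p \<sigma>) s s' \<longrightarrow>
           solution k T p \<sigma> s' \<and>
           fair k T (1 + \<epsilon>) (swap_beta \<epsilon> k (diameter (UNIV :: 'a set))) (opt_cost k T p \<sigma>) s' \<and>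
           total_cost k T s' \<le> opt_cost k T p \<sigma>
             + 8 * (real k * ln (real k) * diameter (UNIV :: 'a set) / \<epsilon>))
     \<and> (\<forall>\<epsilon>\<^sub>0>0. \<exists>C>0. \<forall>n\<ge>2. \<forall>e D. 0 < e \<and> e \<le> \<epsilon>\<^sub>0 \<and> 0 \<le> D \<longrightarrow>
           swap_beta e n D \<le> C * (ln (real n) * D / e))"
proof -
  let ?w = "opt_cost k T p \<sigma>" and ?D = "diameter (UNIV :: 'a set)"
  interpret swapping k T p \<sigma> \<epsilon> ?w ?D
    using assms total_cost_nonneg[of k T s] by unfold_locales auto
  have init: "after_swaps 0 s" using after_swaps_0 assms(3,4) by blast
  have returned: "solution k T p \<sigma> s' \<and> fair k T (1 + \<epsilon>) (swap_beta \<epsilon> k ?D) ?w s' \<and>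
      total_cost k T s' \<le> ?w + 8 * (real k * ln (real k) * ?D / \<epsilon>)"
    if ret: "swapping_returns k T \<epsilon> ?w s s'" for s'
  proof -
    \<comment> \<open>The invariant counts swaps, so the closure is turned into a power.\<close>
    obtain n where "(swap_step k T \<epsilon> ?w ^^ n) s s'"
      using ret rtranclp_imp_relpowp unfolding swapping_returns_def by metis
    then have "after_swaps n s'" using after_swaps_relpowp[OF init] by blast
    then show ?thesis
      using ret total_cost_after_swaps fair_if_not_swap_needed
      by (auto simp: after_swaps_def swapping_returns_def)
  qed
  have "\<exists>C>0. \<forall>n\<ge>2. \<forall>e D. 0 < e \<and> e \<le> \<epsilon>\<^sub>0 \<and> 0 \<le> D \<longrightarrow> swap_beta e n D \<le> C * (ln (real n) * D / e)"
    if "\<epsilon>\<^sub>0 > 0" for \<epsilon>\<^sub>0 :: real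
    using that swap_beta_le by (intro exI[of _ "2 * (1 + \<epsilon>\<^sub>0) * (2 + 5 * \<epsilon>\<^sub>0)"]) auto
  then show ?thesis
    using no_infinite_run[OF init] balancing_time_exists swapping_returns_exists[OF init] returned
    by blast
qed

end
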